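(* $D(\ell_1)>1$; that is, there exist a locally finite metric space $A$ and a constant $C\ge1$ such that every finite subset of $A$ admits a bilipschitz embedding into $\ell_1$ with distortion $\le C$, but $A$ admits no bilipschitz embedding into $\ell_1$ with distortion $\le C$.
   Context: A metric space is locally finite if every ball of finite radius in it has finite cardinality. For metric spaces $(A,d_A),(Y,d_Y)$ and $C\ge1$, a map $f:A\to Y$ is a $C$-bilipschitz embedding if there is $r>0$ with $r\,d_A(u,v)\le d_Y(f(u),f(v))\le rC\,d_A(u,v)$ for all $u,v\in A$; the distortion of $f$ is the least such $C$. For a Banach space $X$ and $\alpha\ge1$, write $D(X)\le\alpha$ if for every locally finite metric space $A$ and every $C\ge1$ such that all finite subsets of $A$ admit bilipschitz embeddings into $X$ with distortion $\le C$, the space $A$ itself admits a bilipschitz embedding into $X$ with distortion $\le\alpha C$. "$D(X)>1$" means that $D(X)\le1$ fails. *)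

theory Defs
  imports "HOL-Analysis.Analysis"
begin

definition metric_on :: "'a set \<Rightarrow> ('a \<Rightarrow> 'a \<Rightarrow> real) \<Rightarrow> bool" where
  "metric_on S d \<longleftrightarrow>
     (\<forall>u\<in>S. \<forall>v\<in>S. 0 \<le> d u v \<and> (d u v = 0 \<longleftrightarrow> u = v) \<and> d u v = d v u) \<and>
     (\<forall>u\<in>S. \<forall>v\<in>S. \<forall>w\<in>S. d u w \<le> d u v + d v w)"

definition locally_finite_metric :: "'a set \<Rightarrow> ('a \<Rightarrow> 'a \<Rightarrow> real) \<Rightarrow> bool" where
  "locally_finite_metric S d \<longleftrightarrow> (\<forall>x\<in>S. \<forall>R::real. finite {y\<in>S. d x y \<le> R})"

definition bilip_embeds ::
  "'a set \<Rightarrow> ('a \<Rightarrow> 'a \<Rightarrow> real) \<Rightarrow> 'b set \<Rightarrow> ('b \<Rightarrow> 'b \<Rightarrow> real) \<Rightarrow> real \<Rightarrow> bool" where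
  "bilip_embeds S d Y dY C \<longleftrightarrow>
     (\<exists>f r. r > 0 \<and> (\<forall>u\<in>S. f u \<in> Y) \<and>
        (\<forall>u\<in>S. \<forall>v\<in>S. r * d u v \<le> dY (f u) (f v) \<and> dY (f u) (f v) \<le> r * C * d u v))"

definition l1 :: "(nat \<Rightarrow> real) set" where
  "l1 = {x. summable (\<lambda>n. \<bar>x n\<bar>)}"

definition l1_dist :: "(nat \<Rightarrow> real) \<Rightarrow> (nat \<Rightarrow> real) \<Rightarrow> real" where
  "l1_dist x y = (\<Sum>n. \<bar>x n - y n\<bar>)"

end

theory Submission
  imports Defs
begin

text \<open>
  We take \<open>C = 1\<close>. Number the dyadic subintervals of \<open>[0,1)\<close> as a binary heap: the intervals of
  length \<open>2\<^sup>-\<^sup>m\<close> are \<open>2\<^sup>m, \<dots>, 2\<^sup>m\<^sup>+\<^sup>1 - 1\<close>, and the halves of \<open>u\<close> are \<open>2u\<close> and \<open>2u + 1\<close>.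
  Give \<open>u\<close> the function \<open>u\<^sup>2 1\<^sub>u\<close> and let \<open>d\<close> be the \<open>L\<^sub>1\<close> distance of these functions. Finitely many
  of them are constant on small dyadic intervals, so they lie isometrically in a finite-dimensional
  \<open>\<ell>\<^sub>1\<close>, and \<open>\<parallel>u\<^sup>2 1\<^sub>u\<parallel> \<ge> u\<close> gives local finiteness.

  Suppose the whole space embeds into \<open>\<ell>\<^sub>1\<close> isometrically, up to a factor \<open>r\<close>, with \<open>0\<close> going to
  the origin and \<open>1\<close> to \<open>g\<close>, so that \<open>\<parallel>g\<parallel> = r\<close>. The images of the level \<open>m\<close> points have pairwise
  Gromov product \<open>0\<close>, so in each coordinate at most one of them has the sign of \<open>g\<close>. Their Gromov
  products with \<open>g\<close> all equal \<open>r 2\<^sup>-\<^sup>m\<close> and add up to \<open>\<parallel>g\<parallel>\<close>, so every coordinate of \<open>g\<close> is consumed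
  by a single one of them and is thus at most \<open>r 2\<^sup>-\<^sup>m\<close>. Letting \<open>m\<close> grow gives \<open>g = 0\<close>,
  a contradiction.
\<close>

section \<open>The dyadic metric\<close>

text \<open>The numbers \<open>i div 2 ^ j\<close> are the heap ancestors of \<open>i\<close>, then
  \<open>0\<close>. The weight vanishes at \<open>0\<close>, which thus gets the zero
  function.\<close>

definition dyadic_fun :: "nat \<Rightarrow> nat \<Rightarrow> real" where
  "dyadic_fun u i = (if \<exists>j. i div 2 ^ j = u then (real u)\<^sup>2 else 0)"

abbreviation level :: "nat \<Rightarrow> nat set" where
  "level n \<equiv> {2 ^ n..<2 ^ Suc n}"

definition level_dist :: "nat \<Rightarrow> nat \<Rightarrow> nat \<Rightarrow> real" where
  "level_dist n u v = (\<Sum>i\<in>level n. \<bar>dyadic_fun u i - dyadic_fun v i\<bar>) / 2 ^ n"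

text \<open>The \<open>L\<^sub>1\<close> distance can be read off at any level that is at least as fine as \<open>u\<close> and \<open>v\<close>.\<close>

definition dyadic_dist :: "nat \<Rightarrow> nat \<Rightarrow> real" where
  "dyadic_dist u v = level_dist (max u v) u v"

lemma dyadic_fun_0 [simp]: "dyadic_fun 0 i = 0"
  by (simp add: dyadic_fun_def)

lemma dyadic_fun_child:
  assumes "i div 2 = k" "u \<noteq> i"
  shows "dyadic_fun u i = dyadic_fun u k"
proof -
  have "(\<exists>j. i div 2 ^ j = u) \<longleftrightarrow> (\<exists>j. k div 2 ^ j = u)"
  proof
    assume "\<exists>j. i div 2 ^ j = u"
    then obtain j where j: "i div 2 ^ j = u" ..
    with assms(2) obtain j' where "j = Suc j'"
      by (cases j) auto
    with j assms(1) show "\<exists>j. k div 2 ^ j = u"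
      by (auto simp: div_mult2_eq)
  next
    assume "\<exists>j. k div 2 ^ j = u"
    then obtain j where "k div 2 ^ j = u" ..
    then have "i div 2 ^ Suc j = u"
      using assms(1) by (simp add: div_mult2_eq)
    then show "\<exists>j. i div 2 ^ j = u" ..
  qed
  then show ?thesis by (simp add: dyadic_fun_def)
qed

text \<open>Intervals of one level are disjoint: a proper ancestor of \<open>i\<close> lies below
  \<open>2 ^ n\<close>.\<close>

lemma dyadic_fun_same_level:
  assumes "t \<in> level n" "i \<in> level n"
  shows "dyadic_fun t i = (if i = t then (real t)\<^sup>2 else 0)"
proof -
  have "i = t" if "i div 2 ^ j = t" for j
  proof (cases j)
    case 0
    with that show ?thesis by simp
  next
    case (Suc j')
    have "t \<le> i div 2"
      using that Suc div_le_dividend[of "i div 2" "2 ^ j'"] by (simp add: div_mult2_eq)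
    moreover have "i div 2 < 2 ^ n" using assms(2) by auto
    ultimately show ?thesis using assms(1) by auto
  qed
  moreover have "\<exists>j. t div 2 ^ j = t"
    by (rule exI[of _ 0]) simp
  ultimately show ?thesis
    by (auto simp: dyadic_fun_def)
qed

lemma dyadic_fun_root:
  assumes "i \<in> level n"
  shows "dyadic_fun 1 i = 1"
proof -
  have "i div 2 ^ n = 1"
    using assms by (intro div_nat_eqI) auto
  then show ?thesis
    unfolding dyadic_fun_def by auto
qed

section \<open>Independence of the level\<close>

lemma level_Suc: "sum g (level (Suc n)) = (\<Sum>i\<in>level n. g (2 * i) + g (2 * i + 1))"
  for g :: "nat \<Rightarrow> real"
proof -
  have "(\<Sum>i\<in>{a..<b}. g (2 * i) + g (2 * i + 1)) = sum g {2 * a..<2 * b}" if "a \<le> b" for a b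
    using that by (induction b rule: dec_induct) (auto simp: add.assoc)
  from this[of "2 ^ n" "2 ^ Suc n"] show ?thesis by simp
qed

text \<open>Neither \<open>u\<close> nor \<open>v\<close> is a cell of the finer level, so both
  halves of a cell inherit its values; the cells double in number and halve in length.\<close>

lemma level_dist_Suc:
  assumes "u < 2 ^ Suc n" "v < 2 ^ Suc n"
  shows "level_dist (Suc n) u v = level_dist n u v"
proof -
  let ?g = "\<lambda>i. \<bar>dyadic_fun u i - dyadic_fun v i\<bar>"
  have "?g (2 * i) + ?g (2 * i + 1) = 2 * ?g i" if "i \<in> level n" for i
    using that assms dyadic_fun_child[of "2 * i" i] dyadic_fun_child[of "2 * i + 1" i]
    by force
  then have "sum ?g (level (Suc n)) = 2 * sum ?g (level n)"
    unfolding level_Suc sum_distrib_left by (rule sum.cong[OF refl])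
  then show ?thesis by (simp add: level_dist_def)
qed

lemma level_dist_mono_eq:
  assumes "n \<le> k" "u < 2 ^ Suc n" "v < 2 ^ Suc n"
  shows "level_dist k u v = level_dist n u v"
  using assms(1)
proof (induction k rule: dec_induct)
  case (step k)
  have "(2::nat) ^ Suc n \<le> 2 ^ Suc k"
    using step.hyps by (intro power_increasing) auto
  with assms have "level_dist (Suc k) u v = level_dist k u v"
    by (intro level_dist_Suc) linarith+
  with step.IH show ?case by simp
qed simp

lemma less_power2_Suc:
  assumes "u \<le> n"
  shows "u < (2::nat) ^ Suc n"
  using order_le_less_trans[OF assms less_exp] by (rule order_less_le_trans) simp

lemma dyadic_dist_eq_level_dist:
  assumes "u < 2 ^ Suc n" "v < 2 ^ Suc n"
  shows "dyadic_dist u v = level_dist n u v"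
proof -
  let ?m = "max u v"
  have "level_dist (max ?m n) u v = level_dist ?m u v"
    by (intro level_dist_mono_eq less_power2_Suc) auto
  moreover have "level_dist (max ?m n) u v = level_dist n u v"
    using assms by (intro level_dist_mono_eq) auto
  ultimately show ?thesis by (simp add: dyadic_dist_def)
qed

section \<open>Metric axioms\<close>

lemma descendant_in_level:
  assumes "0 < u" "u < 2 ^ Suc n"
  shows "\<exists>j. u * 2 ^ j \<in> level n"
  using assms(2)
proof (induction n)
  case 0
  with assms(1) have "u * 2 ^ 0 \<in> level 0" by simp
  then show ?case by blast
next
  case (Suc n)
  show ?case
  proof (cases "u < 2 ^ Suc n")
    case True
    with Suc.IH obtain j where "u * 2 ^ j \<in> level n" by blast
    then have "u * 2 ^ Suc j \<in> level (Suc n)" by auto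
    then show ?thesis by blast
  next
    case False
    with Suc.prems have "u * 2 ^ 0 \<in> level (Suc n)" by simp
    then show ?thesis by blast
  qed
qed

lemma level_dist_eq_0_imp:
  assumes "u < 2 ^ Suc n" "0 < u" "level_dist n u v = 0"
  shows "u = v"
proof -
  \<comment> \<open>On the leftmost descendant of \<open>u\<close> at level \<open>n\<close>, the
    function of \<open>v\<close> must also take the value \<open>u^2\<close>, and distinct points
    have distinct weights.\<close>
  obtain j where j: "u * 2 ^ j \<in> level n"
    using descendant_in_level assms by blast
  have "\<bar>dyadic_fun u (u * 2 ^ j) - dyadic_fun v (u * 2 ^ j)\<bar> = 0"
    using assms(3) j by (simp add: level_dist_def sum_nonneg_eq_0_iff del: power_Suc)
  moreover have "dyadic_fun u (u * 2 ^ j) = (real u)\<^sup>2"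
  proof -
    have "u * 2 ^ j div 2 ^ j = u" by simp
    then show ?thesis unfolding dyadic_fun_def by meson
  qed
  ultimately have "dyadic_fun v (u * 2 ^ j) = (real u)\<^sup>2" by simp
  then show ?thesis
    using assms(2) by (auto simp: dyadic_fun_def split: if_splits)
qed

lemma level_dist_commute: "level_dist n u v = level_dist n v u"
  by (simp add: level_dist_def abs_minus_commute)

lemma metric_on_dyadic_dist: "metric_on UNIV dyadic_dist"
proof -
  have pos: "0 \<le> dyadic_dist u v" for u v
    by (simp add: dyadic_dist_def level_dist_def sum_nonneg)
  have comm: "dyadic_dist u v = dyadic_dist v u" for u v
    by (simp add: dyadic_dist_def level_dist_commute max.commute)
  have zero: "dyadic_dist u v = 0 \<longleftrightarrow> u = v" for u v
  proof
    assume *: "dyadic_dist u v = 0"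
    let ?m = "max u v"
    have "u = v" if "0 < u \<or> 0 < v"
      using that level_dist_eq_0_imp[of u ?m v] level_dist_eq_0_imp[of v ?m u] *
        less_power2_Suc[of u ?m] less_power2_Suc[of v ?m]
      by (auto simp: dyadic_dist_def level_dist_commute[of ?m v])
    then show "u = v" by auto
  qed (simp add: dyadic_dist_def level_dist_def)
  have tri: "dyadic_dist u w \<le> dyadic_dist u v + dyadic_dist v w" for u v w
  proof -
    define n where "n = max u (max v w)"
    have "u < 2 ^ Suc n" "v < 2 ^ Suc n" "w < 2 ^ Suc n"
      by (intro less_power2_Suc; simp add: n_def)+
    moreover have "level_dist n u w \<le> level_dist n u v + level_dist n v w"
      unfolding level_dist_def add_divide_distrib[symmetric] sum.distrib[symmetric]
      by (intro divide_right_mono sum_mono) auto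
    ultimately show ?thesis by (simp only: dyadic_dist_eq_level_dist)
  qed
  show ?thesis
    unfolding metric_on_def by (intro conjI ballI pos zero comm tri)
qed

section \<open>Explicit distances\<close>

lemma dyadic_dist_0_level:
  assumes "t \<in> level n"
  shows "dyadic_dist 0 t = (real t)\<^sup>2 / 2 ^ n"
proof -
  have "dyadic_dist 0 t = level_dist n 0 t"
    using assms by (intro dyadic_dist_eq_level_dist) auto
  also have "(\<Sum>i\<in>level n. \<bar>dyadic_fun 0 i - dyadic_fun t i\<bar>)
      = (\<Sum>i\<in>level n. if i = t then (real t)\<^sup>2 else 0)"
    using assms by (intro sum.cong) (auto simp: dyadic_fun_same_level)
  then have "level_dist n 0 t = (real t)\<^sup>2 / 2 ^ n"
    using assms by (simp add: level_dist_def sum.delta del: power_Suc)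
  finally show ?thesis .
qed

lemma dyadic_dist_same_level:
  assumes "t \<in> level n" "s \<in> level n" "t \<noteq> s"
  shows "dyadic_dist t s = dyadic_dist 0 t + dyadic_dist 0 s"
proof -
  have "dyadic_dist t s = level_dist n t s"
    using assms by (intro dyadic_dist_eq_level_dist) auto
  also have "(\<Sum>i\<in>level n. \<bar>dyadic_fun t i - dyadic_fun s i\<bar>)
      = (\<Sum>i\<in>level n. (if i = t then (real t)\<^sup>2 else 0) + (if i = s then (real s)\<^sup>2 else 0))"
    using assms by (intro sum.cong) (auto simp: dyadic_fun_same_level)
  then have "level_dist n t s = (real t)\<^sup>2 / 2 ^ n + (real s)\<^sup>2 / 2 ^ n"
    using assms
    by (simp add: level_dist_def sum.delta sum.distrib add_divide_distrib del: power_Suc)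
  finally show ?thesis
    using assms by (simp only: dyadic_dist_0_level)
qed

lemma dyadic_dist_root_level:
  assumes "t \<in> level n"
  shows "dyadic_dist 1 t = 1 + dyadic_dist 0 t - 2 / 2 ^ n"
proof -
  have t: "1 \<le> t"
    using assms by (auto intro: order_trans[OF one_le_power])
  then have t2: "1 \<le> (real t)\<^sup>2" by simp
  have "dyadic_dist 1 t = level_dist n 1 t"
    using assms t by (intro dyadic_dist_eq_level_dist) auto
  \<comment> \<open>Every cell contributes \<open>1\<close>, except that the cell \<open>t\<close>
    contributes \<open>t^2 - 1 = 1 + (t^2 - 2)\<close>.\<close>
  also have "(\<Sum>i\<in>level n. \<bar>dyadic_fun 1 i - dyadic_fun t i\<bar>)
      = (\<Sum>i\<in>level n. 1 + (if i = t then (real t)\<^sup>2 - 2 else 0))"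
    using t2 by (intro sum.cong refl) (simp only: dyadic_fun_root dyadic_fun_same_level[OF assms], simp)
  then have "level_dist n 1 t = (2 ^ n + ((real t)\<^sup>2 - 2)) / 2 ^ n"
    using assms by (simp only: level_dist_def sum.distrib sum.delta finite_atLeastLessThan) simp
  finally show ?thesis
    using assms by (simp only: dyadic_dist_0_level) (simp add: field_simps)
qed

section \<open>Local finiteness and finite subsets\<close>

lemma le_dyadic_dist_0: "real t \<le> dyadic_dist 0 t"
proof (cases "t = 0")
  case True
  then show ?thesis by (simp add: dyadic_dist_def level_dist_def)
next
  case False
  then obtain n where n: "2 ^ n \<le> t" "t < 2 ^ Suc n"
    using ex_power_ivl1[of 2 t] by auto
  \<comment> \<open>This growth is the purpose of the squared weight.\<close>
  have "real t * 2 ^ n \<le> real t * real t"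
    using of_nat_mono[OF n(1), where 'a = real] by (intro mult_left_mono) simp_all
  then have "real t \<le> (real t)\<^sup>2 / 2 ^ n"
    by (simp add: field_simps power2_eq_square)
  with n show ?thesis by (simp add: dyadic_dist_0_level[of t n])
qed

lemma locally_finite_dyadic_dist: "locally_finite_metric UNIV dyadic_dist"
  unfolding locally_finite_metric_def
proof (intro ballI allI)
  fix x :: nat and R :: real
  have "y \<le> nat \<lceil>dyadic_dist 0 x + R\<rceil>" if "dyadic_dist x y \<le> R" for y
  proof -
    have "dyadic_dist 0 y \<le> dyadic_dist 0 x + dyadic_dist x y"
      using metric_on_dyadic_dist by (simp add: metric_on_def)
    with that le_dyadic_dist_0[of y] show ?thesis by linarith
  qed
  then show "finite {y \<in> UNIV. dyadic_dist x y \<le> R}"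
    by (intro finite_subset[OF _ finite_atMost[of "nat \<lceil>dyadic_dist 0 x + R\<rceil>"]]) auto
qed

lemma finite_dyadic_embeds_l1:
  assumes "finite F"
  shows "bilip_embeds F dyadic_dist l1 l1_dist 1"
proof -
  obtain n where n: "\<And>u. u \<in> F \<Longrightarrow> u \<le> n"
    using assms unfolding finite_nat_set_iff_bounded_le by blast
  \<comment> \<open>The cells of level \<open>n\<close> serve as coordinates, scaled by their
    length.\<close>
  define f where "f u i = (if i \<in> level n then dyadic_fun u i / 2 ^ n else 0)" for u i
  have "f u \<in> l1" for u
    unfolding l1_def f_def by (auto intro!: summable_finite[of "level n"])
  moreover have "l1_dist (f u) (f v) = dyadic_dist u v" if "u \<in> F" "v \<in> F" for u v
  proof -
    have "l1_dist (f u) (f v) = (\<Sum>i\<in>level n. \<bar>f u i - f v i\<bar>)"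
      unfolding l1_dist_def by (intro suminf_finite) (auto simp: f_def)
    also have "\<dots> = level_dist n u v"
      unfolding level_dist_def sum_divide_distrib
      by (intro sum.cong) (simp_all add: f_def flip: diff_divide_distrib)
    also have "\<dots> = dyadic_dist u v"
      using that by (intro dyadic_dist_eq_level_dist[symmetric] less_power2_Suc n)
    finally show ?thesis .
  qed
  ultimately show ?thesis
    unfolding bilip_embeds_def by (intro exI[of _ f] exI[of _ 1]) auto
qed

section \<open>Gromov products in \<open>\<ell>\<^sub>1\<close>\<close>

text \<open>The Gromov product on the real line based at \<open>0\<close>: the smaller absolute
  value for equal signs, otherwise \<open>0\<close>.\<close>

definition gromov_prod :: "real \<Rightarrow> real \<Rightarrow> real" where
  "gromov_prod a b = (\<bar>a\<bar> + \<bar>b\<bar> - \<bar>a - b\<bar>) / 2"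

lemma gromov_prod_nonneg: "0 \<le> gromov_prod a b"
  by (simp add: gromov_prod_def)

lemma gromov_prod_le_abs: "gromov_prod a b \<le> \<bar>a\<bar>"
  by (simp add: gromov_prod_def)

text \<open>Positivity means that both numbers are nonzero and have the same sign.\<close>

lemma gromov_prod_pos_trans:
  assumes "0 < gromov_prod a b" "0 < gromov_prod a c"
  shows "0 < gromov_prod b c"
  using assms by (auto simp: gromov_prod_def abs_if split: if_splits)

text \<open>Any two indices with positive product against \<open>a\<close> have positive product
  with each other, so \<open>orth\<close> leaves at most one nonzero term.\<close>

lemma sum_gromov_prod_le:
  assumes "finite T"
    and orth: "\<And>s t. s \<in> T \<Longrightarrow> t \<in> T \<Longrightarrow> s \<noteq> t \<Longrightarrow> gromov_prod (b s) (b t) = 0"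
    and bound: "\<And>t. t \<in> T \<Longrightarrow> gromov_prod a (b t) \<le> e" and "0 \<le> e"
  shows "(\<Sum>t\<in>T. gromov_prod a (b t)) \<le> min \<bar>a\<bar> e"
proof (cases "\<exists>t\<in>T. 0 < gromov_prod a (b t)")
  case True
  then obtain t where t: "t \<in> T" "0 < gromov_prod a (b t)" by blast
  have "gromov_prod a (b s) = 0" if "s \<in> T - {t}" for s
    using that t orth[of s t] gromov_prod_pos_trans[of a "b s" "b t"]
      gromov_prod_nonneg[of a "b s"] by force
  then have "(\<Sum>s\<in>T. gromov_prod a (b s)) = gromov_prod a (b t)"
    using assms(1) t(1) by (simp add: sum.remove)
  with t bound gromov_prod_le_abs show ?thesis by simp
next
  case False
  then have "(\<Sum>t\<in>T. gromov_prod a (b t)) = 0"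
    using gromov_prod_nonneg by (intro sum.neutral) (auto simp: less_le)
  with \<open>0 \<le> e\<close> show ?thesis by simp
qed

lemma l1_dist_sums:
  assumes "x \<in> l1" "y \<in> l1"
  shows "(\<lambda>j. \<bar>x j - y j\<bar>) sums l1_dist x y"
proof -
  have "summable (\<lambda>j. \<bar>x j\<bar> + \<bar>y j\<bar>)"
    using assms by (auto simp: l1_def intro: summable_add)
  then have "summable (\<lambda>j. \<bar>x j - y j\<bar>)"
    by (rule summable_comparison_test'[where N = 0]) simp
  then show ?thesis by (simp add: l1_dist_def summable_sums)
qed

lemma gromov_prod_sums:
  assumes "x \<in> l1" "y \<in> l1" "z \<in> l1"
  shows "(\<lambda>j. gromov_prod (x j - z j) (y j - z j))
    sums ((l1_dist x z + l1_dist y z - l1_dist x y) / 2)"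
  using sums_divide[OF sums_diff[OF sums_add[OF l1_dist_sums[OF assms(1,3)]
    l1_dist_sums[OF assms(2,3)]] l1_dist_sums[OF assms(1,2)]], of 2]
  by (simp add: gromov_prod_def)

lemma sums_nonneg_term_le:
  fixes g :: "nat \<Rightarrow> real"
  assumes "g sums s" "\<And>j. 0 \<le> g j"
  shows "g j \<le> s"
  using sum_le_suminf[of g "{j}"] assms by (auto simp: sums_iff)

section \<open>The dyadic metric does not embed\<close>

lemma dyadic_not_embeds_l1: "\<not> bilip_embeds UNIV dyadic_dist l1 l1_dist 1"
proof
  assume "bilip_embeds UNIV dyadic_dist l1 l1_dist 1"
  \<comment> \<open>For distortion \<open>1\<close> the lower and upper bounds coincide.\<close>
  then obtain f r where r: "0 < r" and f: "\<And>u. f u \<in> l1"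
    and iso: "\<And>u v. l1_dist (f u) (f v) = r * dyadic_dist u v"
    unfolding bilip_embeds_def by (simp flip: order_eq_iff add: eq_commute[of "_ * _"]) blast
  define x where "x u j = f u j - f 0 j" for u j
  have comm0: "dyadic_dist u 0 = dyadic_dist 0 u" for u
    using metric_on_dyadic_dist by (simp add: metric_on_def)
  have root: "dyadic_dist 0 1 = 1"
    using dyadic_dist_0_level[of 1 0] by simp
  have prod_sums: "(\<lambda>j. gromov_prod (x u j) (x v j))
      sums (r * (dyadic_dist 0 u + dyadic_dist 0 v - dyadic_dist u v) / 2)" for u v
    using gromov_prod_sums[OF f[of u] f[of v] f[of 0]] by (simp add: x_def iso comm0 algebra_simps)
  have root_sums: "(\<lambda>j. \<bar>x 1 j\<bar>) sums r"
    using l1_dist_sums[OF f[of 1] f[of 0]] by (simp only: x_def iso comm0 root mult_1_right)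
  have small: "\<bar>x 1 j\<bar> \<le> r / 2 ^ n" for j n
  proof -
    \<comment> \<open>The products are nonnegative and sum to \<open>0\<close> over the
      coordinates.\<close>
    have orth: "gromov_prod (x s i) (x t i) = 0"
      if "s \<in> level n" "t \<in> level n" "s \<noteq> t" for s t i
      using sums_nonneg_term_le[OF prod_sums[of s t] gromov_prod_nonneg, of i]
        gromov_prod_nonneg[of "x s i" "x t i"] dyadic_dist_same_level[OF that] by simp
    have sums_t: "(\<lambda>i. gromov_prod (x 1 i) (x t i)) sums (r / 2 ^ n)" if "t \<in> level n" for t
      using prod_sums[of 1 t] unfolding root dyadic_dist_root_level[OF that] by simp
    define p where "p i = (\<Sum>t\<in>level n. gromov_prod (x 1 i) (x t i))" for i
    have p_le: "p i \<le> min \<bar>x 1 i\<bar> (r / 2 ^ n)" for i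
      unfolding p_def using orth r sums_nonneg_term_le[OF sums_t gromov_prod_nonneg]
      by (intro sum_gromov_prod_le) auto
    \<comment> \<open>Each of the \<open>2 ^ n\<close> points of the level contributes
      \<open>r / 2 ^ n\<close>.\<close>
    have "p sums (\<Sum>t\<in>level n. r / 2 ^ n)"
      unfolding p_def by (intro sums_sum sums_t)
    then have "p sums r" by simp
    \<comment> \<open>Since \<open>p\<close> is dominated by \<open>\<bar>x 1 i\<bar>\<close> and
      has the same sum \<open>r\<close>, the two agree in every coordinate.\<close>
    then have "(\<lambda>i. \<bar>x 1 i\<bar> - p i) sums 0"
      using sums_diff[OF root_sums] by fastforce
    moreover have "0 \<le> \<bar>x 1 i\<bar> - p i" for i
      using p_le[of i] by simp
    ultimately have "\<bar>x 1 j\<bar> - p j \<le> 0"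
      by (rule sums_nonneg_term_le)
    with p_le[of j] show ?thesis by simp
  qed
  have "(\<lambda>n. r / 2 ^ n) \<longlonglongrightarrow> 0"
    using tendsto_mult_right_zero[OF LIMSEQ_power_zero[of "1 / 2 :: real"], of r]
    by (simp add: power_one_over field_simps)
  then have "\<bar>x 1 j\<bar> \<le> 0" for j
    by (rule LIMSEQ_le_const) (use small in blast)
  then have "(\<lambda>j. \<bar>x 1 j\<bar>) = (\<lambda>j. 0)" by auto
  with root_sums have "r = 0"
    using sums_unique2[OF _ sums_zero] by metis
  with r show False by simp
qed

theorem theorem1p10:
  shows "\<exists>(A :: nat set) (d :: nat \<Rightarrow> nat \<Rightarrow> real) (C :: real).
           metric_on A d \<and> locally_finite_metric A d \<and> C \<ge> 1 \<and>
           (\<forall>F. F \<subseteq> A \<and> finite F \<longrightarrow> bilip_embeds F d l1 l1_dist C) \<and>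
           \<not> bilip_embeds A d l1 l1_dist C"
proof (intro exI conjI)
  show "metric_on UNIV dyadic_dist" by (rule metric_on_dyadic_dist)
  show "locally_finite_metric UNIV dyadic_dist" by (rule locally_finite_dyadic_dist)
  show "\<forall>F. F \<subseteq> UNIV \<and> finite F \<longrightarrow> bilip_embeds F dyadic_dist l1 l1_dist 1"
    using finite_dyadic_embeds_l1 by blast
  show "\<not> bilip_embeds UNIV dyadic_dist l1 l1_dist 1" by (rule dyadic_not_embeds_l1)
qed simp

end
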